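(* Let $d_1\ge d_2>0$ be integers and $n=2d_1+2d_2+1$. The pseudo-fan $(\Sigma_{(d_1,d_2)},\mathrm{Ver}_{(d_1,d_2)},\Pi_{(d_1,d_2)})$ satisfies the Min--Value Condition (MVC): for every $\beta\in\mathbb{R}^n$ there exists a unique family $(\alpha_v)_{v\in\mathrm{Ver}_{(d_1,d_2)}}$ of real numbers such that $$\beta=\sum_{v\in\mathrm{Ver}_{(d_1,d_2)}}\alpha_v v\qquad\text{and}\qquad \min\{\alpha_v\mid v\in P\}=0\ \text{ for every } P\in\Pi_{(d_1,d_2)}.$$
   Context: Let $d_1\ge d_2>0$ be integers, $n=2d_1+2d_2+1$, $r=(d_1+3)(d_2+3)-6$. Put $I=(\{0,\dots,d_1\}\times\{0,\dots,d_2\})\setminus\{(0,0),(d_1,d_2)\}$. The $r$ column labels are $a_i^1,a_i^2$ ($0\le i\le d_1$), $b_j^1,b_j^2$ ($0\le j\le d_2$), $u_{(i,j)}$ ($(i,j)\in I$). Vertex matrix. $V_{(d_1,d_2)}$ is the integer $n\times r$ matrix with these column labels and with rows labelled $z_0,\dots,z_{d_1}$, $w_0,\dots,w_{d_2}$, $g^{(d_1)}_1,\dots,g^{(d_1)}_{d_1-1}$, $g$, $g^{(d_2)}_1,\dots,g^{(d_2)}_{d_2-1}$. Denote by $\epsilon_\bullet\in\mathbb{Z}^n$ the standard basis vectors indexed by these row labels, with $\epsilon_{g^{(d_1)}_k}:=0$ if $k\notin\{1,\dots,d_1-1\}$ and $\epsilon_{g^{(d_2)}_k}:=0$ if $k\notin\{1,\dots,d_2-1\}$;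 $\delta$ is the Kronecker delta. The columns $v_\rho$ are $v_{a_i^1}=\epsilon_{z_i}$, $v_{a_i^2}=-\epsilon_{z_i}+\epsilon_{g^{(d_1)}_{i-1}}-2\epsilon_{g^{(d_1)}_i}+\epsilon_{g^{(d_1)}_{i+1}}+(\delta_{i,0}-\delta_{i,1})\epsilon_g$, $v_{b_j^1}=\epsilon_{w_j}$, $v_{b_j^2}=-\epsilon_{w_j}+\epsilon_{g^{(d_2)}_{j-1}}-2\epsilon_{g^{(d_2)}_j}+\epsilon_{g^{(d_2)}_{j+1}}+(-\delta_{j,0}+\delta_{j,1})\epsilon_g$, $v_{u_{(0,j)}}=-\epsilon_g+\epsilon_{g^{(d_2)}_j}$ ($1\le j\le d_2$), $v_{u_{(i,j)}}=\epsilon_{g^{(d_1)}_i}+\delta_{j,0}\epsilon_g+\epsilon_{g^{(d_2)}_j}$ ($1\le i\le d_1-1$, $0\le j\le d_2$), $v_{u_{(d_1,j)}}=\delta_{j,0}\epsilon_g+\epsilon_{g^{(d_2)}_j}$ ($0\le j\le d_2-1$). Let $\mathrm{Ver}_{(d_1,d_2)}$ be the set of the $r$ columns of $V_{(d_1,d_2)}$. $\Pi_{(d_1,d_2)}$ is the collection of the following subsets of $\mathrm{Ver}_{(d_1,d_2)}$: $\{v_{a_0^1},v_{a_0^2}\}$, $\{v_{a_{d_1}^1},v_{a_{d_1}^2}\}$, $\{v_{b_0^1},v_{b_0^2}\}$, $\{v_{b_{d_2}^1},v_{b_{d_2}^2}\}$; $\{v_{a_i^1},v_{a_i^2},v_{u_{(i,j)}}\}$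 for $1\le i\le d_1-1$, $0\le j\le d_2$; $\{v_{b_j^1},v_{b_j^2},v_{u_{(i,j)}}\}$ for $1\le j\le d_2-1$, $0\le i\le d_1$; and $\{v_{u_{(i,j)}},v_{u_{(k,l)}}\}$ for $0\le i<k\le d_1$, $0\le l<j\le d_2$. $\Sigma_{(d_1,d_2)}$ is the set of all cones $\langle S\rangle_{\ge0}$ (nonnegative real combinations of $S$) with $S\subset\mathrm{Ver}_{(d_1,d_2)}$ containing no member of $\Pi_{(d_1,d_2)}$. Pseudo-fan: a triple $(\Sigma,V,\Pi)$ with $V$ a finite set of vectors, $\Pi$ a finite collection of non-empty subsets of $V$ with union $V$ and none contained in another, and $\Sigma=\{\langle S\rangle_{\ge0}: S\subset V \text{ contains no member of }\Pi\}$. *)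

theory Defs
  imports Complex_Main "HOL-Library.FuncSet"
begin

text \<open>
  Vectors are real functions on row labels; for a finite set \<open>R\<close> of row labels, the space
  of functions vanishing outside \<open>R\<close> is the Euclidean space with coordinates indexed by \<open>R\<close>.
\<close>

definition coord_space :: "'r set \<Rightarrow> ('r \<Rightarrow> real) set" where
  "coord_space R = {\<beta>. \<forall>x. x \<notin> R \<longrightarrow> \<beta> x = 0}"

definition lin_comb :: "(('r \<Rightarrow> real) \<Rightarrow> real) \<Rightarrow> ('r \<Rightarrow> real) set \<Rightarrow> 'r \<Rightarrow> real" where
  "lin_comb \<alpha> S = (\<lambda>x. \<Sum>v\<in>S. \<alpha> v * v x)"

definition nonneg_cone :: "('r \<Rightarrow> real) set \<Rightarrow> ('r \<Rightarrow> real) set" where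
  "nonneg_cone S = {lin_comb \<alpha> S | \<alpha>. \<forall>v\<in>S. 0 \<le> \<alpha> v}"

definition cones_avoiding ::
    "('r \<Rightarrow> real) set \<Rightarrow> ('r \<Rightarrow> real) set set \<Rightarrow> ('r \<Rightarrow> real) set set" where
  "cones_avoiding V \<P> = {nonneg_cone S | S. S \<subseteq> V \<and> (\<forall>P\<in>\<P>. \<not> P \<subseteq> S)}"

type_synonym 'r fan_triple =
  "('r \<Rightarrow> real) set set \<times> ('r \<Rightarrow> real) set \<times> ('r \<Rightarrow> real) set set"

definition pseudo_fan :: "'r set \<Rightarrow> 'r fan_triple \<Rightarrow> bool" where
  "pseudo_fan R = (\<lambda>(\<Sigma>, V, \<P>).
     finite V \<and> V \<subseteq> coord_space R \<and>
     finite \<P> \<and> {} \<notin> \<P> \<and> \<Union>\<P> = V \<and>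
     (\<forall>P\<in>\<P>. \<forall>Q\<in>\<P>. P \<subseteq> Q \<longrightarrow> P = Q) \<and>
     \<Sigma> = cones_avoiding V \<P>)"

text \<open>
  A family of reals indexed by \<open>V\<close> is an extensional function on \<open>V\<close>, so that the
  uniqueness below concerns only the values on \<open>V\<close>.
\<close>

definition min_value_condition :: "'r set \<Rightarrow> 'r fan_triple \<Rightarrow> bool" where
  "min_value_condition R = (\<lambda>(\<Sigma>, V, \<P>).
     \<forall>\<beta>\<in>coord_space R. \<exists>!\<alpha>. \<alpha> \<in> V \<rightarrow>\<^sub>E (UNIV :: real set) \<and>
       \<beta> = lin_comb \<alpha> V \<and> (\<forall>P\<in>\<P>. Min (\<alpha> ` P) = 0))"

datatype row_label = Z nat | W nat | G1 nat | G | G2 nat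

datatype col_label = A1 nat | A2 nat | B1 nat | B2 nat | U nat nat

definition row_labels :: "nat \<Rightarrow> nat \<Rightarrow> row_label set" where
  "row_labels d1 d2 =
     Z ` {0..d1} \<union> W ` {0..d2} \<union> G1 ` {1..<d1} \<union> {G} \<union> G2 ` {1..<d2}"

definition u_indices :: "nat \<Rightarrow> nat \<Rightarrow> (nat \<times> nat) set" where
  "u_indices d1 d2 = {0..d1} \<times> {0..d2} - {(0, 0), (d1, d2)}"

definition col_labels :: "nat \<Rightarrow> nat \<Rightarrow> col_label set" where
  "col_labels d1 d2 =
     A1 ` {0..d1} \<union> A2 ` {0..d1} \<union> B1 ` {0..d2} \<union> B2 ` {0..d2} \<union>
     case_prod U ` u_indices d1 d2"

definition eps :: "row_label \<Rightarrow> row_label \<Rightarrow> int" where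
  "eps x = (\<lambda>y. of_bool (y = x))"

definition eps_G1 :: "nat \<Rightarrow> nat \<Rightarrow> row_label \<Rightarrow> int" where
  "eps_G1 d1 k = (if k \<in> {1..<d1} then eps (G1 k) else (\<lambda>_. 0))"

definition eps_G2 :: "nat \<Rightarrow> nat \<Rightarrow> row_label \<Rightarrow> int" where
  "eps_G2 d2 k = (if k \<in> {1..<d2} then eps (G2 k) else (\<lambda>_. 0))"

text \<open>
  The integer matrix, given column by column. The index \<open>i - 1\<close> is truncated to \<open>0\<close> at
  \<open>i = 0\<close>, which is harmless since \<open>eps_G1 d1 0\<close> and \<open>eps_G2 d2 0\<close> vanish. The values at
  labels outside \<open>col_labels d1 d2\<close> are irrelevant; in particular the last case for \<open>U i j\<close>
  is only used for \<open>i = d1\<close>.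
\<close>

fun vertex_column :: "nat \<Rightarrow> nat \<Rightarrow> col_label \<Rightarrow> row_label \<Rightarrow> int" where
  "vertex_column d1 d2 (A1 i) x = eps (Z i) x"
| "vertex_column d1 d2 (A2 i) x =
     - eps (Z i) x + eps_G1 d1 (i - 1) x - 2 * eps_G1 d1 i x + eps_G1 d1 (i + 1) x
     + (of_bool (i = 0) - of_bool (i = 1)) * eps G x"
| "vertex_column d1 d2 (B1 j) x = eps (W j) x"
| "vertex_column d1 d2 (B2 j) x =
     - eps (W j) x + eps_G2 d2 (j - 1) x - 2 * eps_G2 d2 j x + eps_G2 d2 (j + 1) x
     + (- of_bool (j = 0) + of_bool (j = 1)) * eps G x"
| "vertex_column d1 d2 (U i j) x =
     (if i = 0 then - eps G x + eps_G2 d2 j x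
      else if i < d1 then eps_G1 d1 i x + of_bool (j = 0) * eps G x + eps_G2 d2 j x
      else of_bool (j = 0) * eps G x + eps_G2 d2 j x)"

definition vertex :: "nat \<Rightarrow> nat \<Rightarrow> col_label \<Rightarrow> row_label \<Rightarrow> real" where
  "vertex d1 d2 c = (\<lambda>x. real_of_int (vertex_column d1 d2 c x))"

definition fan_Ver :: "nat \<Rightarrow> nat \<Rightarrow> (row_label \<Rightarrow> real) set" where
  "fan_Ver d1 d2 = vertex d1 d2 ` col_labels d1 d2"

definition label_Pi :: "nat \<Rightarrow> nat \<Rightarrow> col_label set set" where
  "label_Pi d1 d2 =
     {{A1 0, A2 0}, {A1 d1, A2 d1}, {B1 0, B2 0}, {B1 d2, B2 d2}} \<union>
     {{A1 i, A2 i, U i j} | i j. 1 \<le> i \<and> i < d1 \<and> j \<le> d2} \<union>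
     {{B1 j, B2 j, U i j} | i j. 1 \<le> j \<and> j < d2 \<and> i \<le> d1} \<union>
     {{U i j, U k l} | i j k l. i < k \<and> k \<le> d1 \<and> l < j \<and> j \<le> d2}"

definition fan_Pi :: "nat \<Rightarrow> nat \<Rightarrow> (row_label \<Rightarrow> real) set set" where
  "fan_Pi d1 d2 = (`) (vertex d1 d2) ` label_Pi d1 d2"

definition fan_Sigma :: "nat \<Rightarrow> nat \<Rightarrow> (row_label \<Rightarrow> real) set set" where
  "fan_Sigma d1 d2 = cones_avoiding (fan_Ver d1 d2) (fan_Pi d1 d2)"

lemma card_row_labels:
  assumes "0 < d1" and "0 < d2"
  shows "card (row_labels d1 d2) = 2 * d1 + 2 * d2 + 1"
proof -
  have "card (row_labels d1 d2) =
      card (Z ` {0..d1}) + card (W ` {0..d2}) + card (G1 ` {1..<d1}) + card {G} + card (G2 ` {1..<d2})"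
    unfolding row_labels_def by (subst card_Un_disjoint; (auto simp del: Un_insert_right)?)+
  then show ?thesis using assms by (simp add: card_image inj_on_def)
qed

lemma vertex_column_U:
  "vertex_column d1 d2 (U i j) (Z k) = 0"
  "vertex_column d1 d2 (U i j) (W k) = 0"
  "vertex_column d1 d2 (U i j) (G1 k) = of_bool (0 < i \<and> i < d1 \<and> k = i)"
  "vertex_column d1 d2 (U i j) (G2 k) = of_bool (0 < j \<and> j < d2 \<and> k = j)"
  "vertex_column d1 d2 (U i j) G = (if i = 0 then -1 else of_bool (j = 0))"
  by (auto simp: eps_def eps_G1_def eps_G2_def)

lemma vertex_column_A_B:
  "vertex_column d1 d2 (A1 i) (Z k) = of_bool (k = i)"
  "vertex_column d1 d2 (A1 i) (W k) = 0"
  "vertex_column d1 d2 (A2 i) (Z k) = - of_bool (k = i)"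
  "vertex_column d1 d2 (A2 i) (W k) = 0"
  "vertex_column d1 d2 (B1 i) (W k) = of_bool (k = i)"
  "vertex_column d1 d2 (B1 i) (Z k) = 0"
  "vertex_column d1 d2 (B2 i) (W k) = - of_bool (k = i)"
  "vertex_column d1 d2 (B2 i) (Z k) = 0"
  by (auto simp: eps_def eps_G1_def eps_G2_def)

lemma inj_on_vertex:
  assumes "0 < d1" and "0 < d2"
  shows "inj_on (vertex d1 d2) (col_labels d1 d2)"
proof (rule inj_onI)
  fix c c'
  assume c: "c \<in> col_labels d1 d2" and c': "c' \<in> col_labels d1 d2"
    and "vertex d1 d2 c = vertex d1 d2 c'"
  then have eq: "vertex_column d1 d2 c x = vertex_column d1 d2 c' x" for x
    by (metis vertex_def of_int_eq_iff)
  define k where "k c = (case c of A1 i \<Rightarrow> i | A2 i \<Rightarrow> i | B1 i \<Rightarrow> i | B2 i \<Rightarrow> i | U i j \<Rightarrow> 0)" for c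
  have U: "i = k \<and> j = l" if "c = U i j" "c' = U k l" for i j k l
  proof -
    have ranges: "i \<le> d1" "j \<le> d2" "k \<le> d1" "l \<le> d2" "(i, j) \<noteq> (0, 0)" "(k, l) \<noteq> (0, 0)"
      "(i, j) \<noteq> (d1, d2)" "(k, l) \<noteq> (d1, d2)"
      using c c' that by (auto simp: col_labels_def u_indices_def)
    show ?thesis
      using eq[of G] eq[of "G1 i"] eq[of "G1 k"] eq[of "G2 j"] eq[of "G2 l"] ranges assms
      unfolding that vertex_column_U of_bool_def by (auto split: if_splits)
  qed
  have notU: "c = c'" if "\<nexists>i j k l. c = U i j \<and> c' = U k l"
    using eq[of "Z (k c)"] eq[of "Z (k c')"] eq[of "W (k c)"] eq[of "W (k c')"] that
    by (cases c; cases c')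
      (simp_all add: k_def vertex_column_U vertex_column_A_B of_bool_def
        del: vertex_column.simps split: if_splits)
  show "c = c'"
  proof (cases "\<exists>i j k l. c = U i j \<and> c' = U k l")
    case True
    then show ?thesis using U by blast
  qed (rule notU)
qed

lemma finite_u_indices: "finite (u_indices d1 d2)"
  unfolding u_indices_def by simp

lemma card_fan_Ver:
  assumes "0 < d1" and "0 < d2"
  shows "card (fan_Ver d1 d2) = (d1 + 3) * (d2 + 3) - 6"
proof -
  have u: "card (u_indices d1 d2) = (d1 + 1) * (d2 + 1) - 2"
    unfolding u_indices_def using assms by (subst card_Diff_subset) auto
  have "card (col_labels d1 d2) = card (A1 ` {0..d1}) + card (A2 ` {0..d1}) +
      card (B1 ` {0..d2}) + card (B2 ` {0..d2}) + card (case_prod U ` u_indices d1 d2)"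
    unfolding col_labels_def
    by (subst card_Un_disjoint; (auto simp: finite_u_indices)?)+
  also have "\<dots> = 2 * (d1 + 1) + 2 * (d2 + 1) + ((d1 + 1) * (d2 + 1) - 2)"
    using u by (simp add: card_image inj_on_def split: prod.splits)
  also have "\<dots> = (d1 + 3) * (d2 + 3) - 6"
    using assms by (cases d1; cases d2) (simp_all add: algebra_simps)
  finally show ?thesis
    unfolding fan_Ver_def using card_image[OF inj_on_vertex[OF assms]] by simp
qed

lemma vertex_in_coord_space:
  assumes "c \<in> col_labels d1 d2"
  shows "vertex d1 d2 c \<in> coord_space (row_labels d1 d2)"
proof -
  have "vertex_column d1 d2 c x = 0" if x: "x \<notin> row_labels d1 d2" for x
  proof -
    have "eps_G1 d1 i x = 0" "eps_G2 d2 i x = 0" "eps G x = 0" for i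
      using x by (auto simp: row_labels_def eps_def eps_G1_def eps_G2_def)
    moreover have "eps (Z i) x = 0" if "i \<le> d1" for i
      using x that by (auto simp: row_labels_def eps_def)
    moreover have "eps (W j) x = 0" if "j \<le> d2" for j
      using x that by (auto simp: row_labels_def eps_def)
    ultimately show ?thesis
      using assms by (cases c) (auto simp: col_labels_def)
  qed
  then show ?thesis by (simp add: coord_space_def vertex_def)
qed

lemma label_Pi_I:
  "1 \<le> i \<Longrightarrow> i < d1 \<Longrightarrow> j \<le> d2 \<Longrightarrow> {A1 i, A2 i, U i j} \<in> label_Pi d1 d2"
  "1 \<le> j \<Longrightarrow> j < d2 \<Longrightarrow> i \<le> d1 \<Longrightarrow> {B1 j, B2 j, U i j} \<in> label_Pi d1 d2"
  "i < k \<Longrightarrow> k \<le> d1 \<Longrightarrow> l < j \<Longrightarrow> j \<le> d2 \<Longrightarrow> {U i j, U k l} \<in> label_Pi d1 d2"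
  unfolding label_Pi_def
  by (rule UnI1, rule UnI1, rule UnI2, (intro CollectI exI conjI, rule refl; assumption))
    ((rule UnI1, rule UnI2, (intro CollectI exI conjI, rule refl; assumption)),
     (rule UnI2, (intro CollectI exI conjI, rule refl; assumption)))

lemma Union_label_Pi:
  assumes "0 < d1" and "0 < d2"
  shows "\<Union>(label_Pi d1 d2) = col_labels d1 d2"
proof
  show "\<Union>(label_Pi d1 d2) \<subseteq> col_labels d1 d2"
    using assms by (auto simp: label_Pi_def col_labels_def u_indices_def)
next
  have A: "A1 i \<in> \<Union>(label_Pi d1 d2) \<and> A2 i \<in> \<Union>(label_Pi d1 d2)" if le: "i \<le> d1" for i
  proof -
    consider "i = 0" | "i = d1" | "1 \<le> i" "i < d1" using le by force
    then show ?thesis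
    proof cases
      case 3
      then have "{A1 i, A2 i, U i 0} \<in> label_Pi d1 d2" by (intro label_Pi_I) auto
      then show ?thesis by blast
    qed (auto simp: label_Pi_def)
  qed
  have B: "B1 j \<in> \<Union>(label_Pi d1 d2) \<and> B2 j \<in> \<Union>(label_Pi d1 d2)" if le: "j \<le> d2" for j
  proof -
    consider "j = 0" | "j = d2" | "1 \<le> j" "j < d2" using le by force
    then show ?thesis
    proof cases
      case 3
      then have "{B1 j, B2 j, U 0 j} \<in> label_Pi d1 d2" by (intro label_Pi_I) auto
      then show ?thesis by blast
    qed (auto simp: label_Pi_def)
  qed
  have U: "U i j \<in> \<Union>(label_Pi d1 d2)" if "(i, j) \<in> u_indices d1 d2" for i j
  proof -
    have ij: "i \<le> d1" "j \<le> d2" "i = 0 \<Longrightarrow> 0 < j" "i = d1 \<Longrightarrow> j < d2"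
      using that by (auto simp: u_indices_def)
    consider "i = 0" | "i = d1" | "1 \<le> i" "i < d1" using ij by force
    then show ?thesis
    proof cases
      case 1
      then have "{U i j, U d1 0} \<in> label_Pi d1 d2" using ij assms by (intro label_Pi_I) auto
      then show ?thesis by blast
    next
      case 2
      then have "{U 0 d2, U i j} \<in> label_Pi d1 d2" using ij assms by (intro label_Pi_I) auto
      then show ?thesis by blast
    next
      case 3
      then have "{A1 i, A2 i, U i j} \<in> label_Pi d1 d2" using ij by (intro label_Pi_I) auto
      then show ?thesis by blast
    qed
  qed
  show "col_labels d1 d2 \<subseteq> \<Union>(label_Pi d1 d2)"
    unfolding col_labels_def using A B U by auto
qed

lemma label_Pi_E:
  assumes "P \<in> label_Pi d1 d2"
  obtains (A) i where "P = {A1 i, A2 i}" "i = 0 \<or> i = d1"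
  | (B) j where "P = {B1 j, B2 j}" "j = 0 \<or> j = d2"
  | (AU) i j where "P = {A1 i, A2 i, U i j}" "1 \<le> i" "i < d1"
  | (BU) i j where "P = {B1 j, B2 j, U i j}" "1 \<le> j" "j < d2"
  | (UU) i j k l where "P = {U i j, U k l}" "i < k" "l < j"
  using assms unfolding label_Pi_def Un_iff mem_Collect_eq
proof (elim disjE exE conjE)
  assume "P \<in> {{A1 0, A2 0}, {A1 d1, A2 d1}, {B1 0, B2 0}, {B1 d2, B2 d2}}"
  then have "P = {A1 0, A2 0} \<or> P = {A1 d1, A2 d1} \<or> P = {B1 0, B2 0} \<or> P = {B1 d2, B2 d2}"
    by (simp only: insert_iff empty_iff simp_thms)
  then show thesis using A[of 0] A[of d1] B[of 0] B[of d2] by argo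
qed (rule AU BU UU; assumption)+

lemma label_Pi_antichain:
  assumes "P \<in> label_Pi d1 d2" and "Q \<in> label_Pi d1 d2" and "P \<subseteq> Q"
  shows "P = Q"
  by (rule label_Pi_E[OF assms(1)]; rule label_Pi_E[OF assms(2)]; insert assms(3); force)

lemma pseudo_fan_Sigma_Ver_Pi:
  assumes "0 < d1" and "0 < d2"
  shows "pseudo_fan (row_labels d1 d2) (fan_Sigma d1 d2, fan_Ver d1 d2, fan_Pi d1 d2)"
proof -
  have fin: "finite (col_labels d1 d2)"
    by (simp add: col_labels_def finite_u_indices)
  have "\<Union>(fan_Pi d1 d2) = vertex d1 d2 ` \<Union>(label_Pi d1 d2)"
    unfolding fan_Pi_def by blast
  then have un: "\<Union>(fan_Pi d1 d2) = fan_Ver d1 d2"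
    unfolding fan_Ver_def Union_label_Pi[OF assms] .
  have finV: "finite (fan_Ver d1 d2)"
    unfolding fan_Ver_def using fin by simp
  have finP: "finite (fan_Pi d1 d2)"
    by (rule finite_UnionD) (simp add: un finV)
  have "{} \<notin> fan_Pi d1 d2"
    unfolding fan_Pi_def label_Pi_def by auto
  moreover have "P = Q" if "P \<in> fan_Pi d1 d2" "Q \<in> fan_Pi d1 d2" "P \<subseteq> Q" for P Q
  proof -
    obtain P' Q' where P': "P' \<in> label_Pi d1 d2" "P = vertex d1 d2 ` P'"
      and Q': "Q' \<in> label_Pi d1 d2" "Q = vertex d1 d2 ` Q'"
      using \<open>P \<in> fan_Pi d1 d2\<close> \<open>Q \<in> fan_Pi d1 d2\<close> unfolding fan_Pi_def by blast
    have "P' \<subseteq> col_labels d1 d2" "Q' \<subseteq> col_labels d1 d2"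
      using P' Q' Union_label_Pi[OF assms] by blast+
    then have "P' \<subseteq> Q'"
      using inj_on_image_mem_iff[OF inj_on_vertex[OF assms]] \<open>P \<subseteq> Q\<close> P'(2) Q'(2) by blast
    then show ?thesis
      using label_Pi_antichain P' Q' by metis
  qed
  moreover have "fan_Ver d1 d2 \<subseteq> coord_space (row_labels d1 d2)"
    unfolding fan_Ver_def using vertex_in_coord_space by blast
  ultimately show ?thesis
    unfolding pseudo_fan_def fan_Sigma_def using un finV finP by blast
qed

end

theory Submission
  imports Defs
begin

text \<open>
  Write \<open>x i\<close>, \<open>y j\<close> and \<open>u i j\<close> for the coefficients of the columns \<open>A2 i\<close>, \<open>B2 j\<close> and
  \<open>U i j\<close>. The rows \<open>Z\<close> and \<open>W\<close> turn nonnegativity of the coefficients of \<open>A1\<close> and \<open>B1\<close> into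
  lower bounds on \<open>x\<close> and \<open>y\<close>. The rows \<open>G1\<close> say that the second difference of \<open>x\<close> plus the
  row sums of \<open>u\<close> is prescribed, and by the minimum conditions such a row sum can be positive
  only where \<open>x\<close> touches its bound: \<open>x\<close>, and likewise \<open>y\<close>, solves a discrete obstacle
  problem, which has exactly one solution. This determines the inner row and column sums of
  \<open>u\<close>. The conditions on pairs of \<open>U\<close> say that the support of \<open>u\<close> is a monotone chain;
  together with the row \<open>G\<close> they determine the remaining marginals, and a nonnegative matrix
  supported on a monotone chain is determined by its marginals: with \<open>R i\<close> and \<open>S j\<close> the
  partial sums of the marginals, the sum of \<open>u\<close> over \<open>{..<i} \<times> {..<j}\<close> is \<open>min (R i) (S j)\<close>.
\<close>

section \<open>The discrete obstacle problem\<close>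

text \<open>Contact is imposed at both ends because there the sets in \<open>label_Pi\<close> pair
  \<open>A1\<close> with \<open>A2\<close> alone. At an inner index a \<open>U\<close> joins them,
  so contact may fail, but then the second difference has to equal \<open>g i\<close>.\<close>

definition solves_obstacle ::
    "nat \<Rightarrow> (nat \<Rightarrow> real) \<Rightarrow> (nat \<Rightarrow> real) \<Rightarrow> (nat \<Rightarrow> real) \<Rightarrow> bool" where
  "solves_obstacle d g p x \<longleftrightarrow> x 0 = p 0 \<and> x d = p d \<and> (\<forall>i\<le>d. p i \<le> x i) \<and>
     (\<forall>i\<in>{1..<d}. x (i - 1) - 2 * x i + x (i + 1) \<le> g i \<and>
        (x i = p i \<or> x (i - 1) - 2 * x i + x (i + 1) = g i))"

text \<open>Maximum principle. At a positive maximum of \<open>x - y\<close> the function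
  \<open>x\<close> lies strictly above \<open>y\<close>, hence above the obstacle, so its second
  difference equals \<open>g\<close> while that of \<open>y\<close> is at most \<open>g\<close>. The
  second difference of \<open>x - y\<close> is then nonnegative, which a suitably chosen maximum
  contradicts.\<close>

lemma obstacle_le:
  assumes x: "solves_obstacle d g p x" and y: "solves_obstacle d g p y" and "i \<le> d"
  shows "x i \<le> y i"
proof (rule ccontr)
  assume "\<not> x i \<le> y i"
  define D where "D i = x i - y i" for i
  define M where "M = Max (D ` {..d})"
  have M: "D i \<le> M" if "i \<le> d" for i
    unfolding M_def using that by (intro Max_ge) auto
  have "M > 0"
    using M[OF \<open>i \<le> d\<close>] \<open>\<not> x i \<le> y i\<close> by (simp add: D_def)
  have "M \<in> D ` {..d}"
    unfolding M_def by (intro Max_in) auto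
  then have ex: "\<exists>k. k \<le> d \<and> D k = M" by auto
  \<comment> \<open>The leftmost maximum has a strictly smaller left neighbour, so the second
    difference of \<open>D\<close> at \<open>k\<close> is strictly negative.\<close>
  define k where "k = (LEAST k. k \<le> d \<and> D k = M)"
  have k: "k \<le> d" "D k = M"
    using LeastI_ex[OF ex] by (auto simp: k_def)
  have "D 0 = 0" "D d = 0"
    using x y by (auto simp: D_def solves_obstacle_def)
  then have k': "0 < k" "k < d"
    using k \<open>M > 0\<close> by (metis less_irrefl gr0I, metis less_irrefl le_neq_implies_less)
  have "D (k - 1) \<noteq> M"
    using not_less_Least[of "k - 1" "\<lambda>k. k \<le> d \<and> D k = M"] k' by (auto simp: k_def)
  moreover have "k - 1 \<le> d" "k + 1 \<le> d" using k' by auto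
  ultimately have "D (k - 1) < M" "D (k + 1) \<le> M"
    using M[of "k - 1"] M[of "k + 1"] by (auto simp: less_le)
  moreover have "p k \<le> y k" "y (k - 1) - 2 * y k + y (k + 1) \<le> g k"
    "x k = p k \<or> x (k - 1) - 2 * x k + x (k + 1) = g k"
    using x y k' by (auto simp: solves_obstacle_def)
  ultimately show False
    using k(2) \<open>M > 0\<close> by (auto simp: D_def)
qed

lemma obstacle_unique:
  assumes "solves_obstacle d g p x" and "solves_obstacle d g p y" and "i \<le> d"
  shows "x i = y i"
  using obstacle_le assms by (meson order_antisym)

text \<open>Perron's method: the pointwise infimum of all supersolutions above the obstacle.\<close>

lemma obstacle_exists: "\<exists>x. solves_obstacle d g p x"
proof -
  define super where "super = {y :: nat \<Rightarrow> real. (\<forall>i\<le>d. p i \<le> y i) \<and>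
    (\<forall>i\<in>{1..<d}. y (i - 1) - 2 * y i + y (i + 1) \<le> g i)}"
  define x where "x i = (INF y\<in>super. y i)" for i
  \<comment> \<open>To see that \<open>super\<close> is nonempty, solve the recursion with second
    difference exactly \<open>g\<close> and raise the solution by the constant \<open>C\<close>
    until it clears the obstacle. The pair \<open>q i\<close> holds two consecutive values, starting
    from zero.\<close>
  obtain h :: "nat \<Rightarrow> real" where h: "\<And>i. h (Suc (Suc i)) = g (Suc i) + 2 * h (Suc i) - h i"
  proof -
    define q :: "nat \<Rightarrow> real \<times> real"
      where "q = rec_nat (0, 0) (\<lambda>i (a, b). (b, g (Suc i) + 2 * b - a))"
    have "snd (q i) = fst (q (Suc i))" "snd (q (Suc i)) = g (Suc i) + 2 * snd (q i) - fst (q i)" for i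
      by (auto simp: q_def split: prod.splits)
    then show thesis
      by (intro that[of "\<lambda>i. fst (q i)"]) metis
  qed
  define C where "C = Max ((\<lambda>i. p i - h i) ` {..d})"
  have "(\<lambda>i. h i + C) \<in> super"
  proof -
    have "p i - h i \<le> C" if "i \<le> d" for i
      unfolding C_def using that by (intro Max_ge) auto
    moreover have "h (i - 1) - 2 * h i + h (i + 1) = g i" if "i \<in> {1..<d}" for i
      using h[of "i - 1"] that by simp
    ultimately show ?thesis
      by (force simp: super_def algebra_simps)
  qed
  then have ne: "super \<noteq> {}" by blast
  have le: "x i \<le> y i" if "y \<in> super" "i \<le> d" for y i
    unfolding x_def
    by (rule cINF_lower[OF _ that(1)]) (rule bdd_belowI2[of _ "p i"], use that in \<open>auto simp: super_def\<close>)
  have ge: "b \<le> x i" if "\<And>y. y \<in> super \<Longrightarrow> b \<le> y i" for b i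
    unfolding x_def using ne that by (rule cINF_greatest)
  have px: "p i \<le> x i" if "i \<le> d" for i
    using that by (intro ge) (auto simp: super_def)
  have sx: "x (i - 1) - 2 * x i + x (i + 1) \<le> g i" if "i \<in> {1..<d}" for i
  proof -
    \<comment> \<open>Solved for the value at \<open>i\<close>, the inequality has a lower bound
      that increases with the two neighbours, so it passes to the infimum.\<close>
    have "(x (i - 1) + x (i + 1) - g i) / 2 \<le> x i"
    proof (rule ge)
      fix y assume y: "y \<in> super"
      then have "x (i - 1) \<le> y (i - 1)" "x (i + 1) \<le> y (i + 1)"
        using le that by auto
      moreover have "y (i - 1) - 2 * y i + y (i + 1) \<le> g i"
        using y that by (auto simp: super_def)
      ultimately show "(x (i - 1) + x (i + 1) - g i) / 2 \<le> y i" by simp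
    qed
    then show ?thesis by simp
  qed
  \<comment> \<open>Lowering a single value preserves the inequalities at all other indices.\<close>
  have upd: "x k \<le> b" if "k \<le> d" "p k \<le> b" "b \<le> x k"
    "k \<in> {1..<d} \<Longrightarrow> x (k - 1) - 2 * b + x (k + 1) \<le> g k" for k b
  proof -
    have "x(k := b) \<in> super"
      unfolding super_def
    proof (intro CollectI conjI ballI allI impI)
      fix i assume i: "i \<in> {1..<d}"
      show "(x(k := b)) (i - 1) - 2 * (x(k := b)) i + (x(k := b)) (i + 1) \<le> g i"
        using that sx[OF i] i by (auto simp: fun_upd_def)
    qed (use that px in auto)
    from le[OF this that(1)] show ?thesis by simp
  qed
  \<comment> \<open>No second difference is centred at an endpoint, so there the value may be
    lowered all the way to the obstacle.\<close>
  have "x i = p i" if "i = 0 \<or> i = d" for i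
    using upd[of i "p i"] px[of i] that by auto
  moreover have "x i = p i \<or> x (i - 1) - 2 * x i + x (i + 1) = g i" if "i \<in> {1..<d}" for i
  proof -
    \<comment> \<open>With its neighbours fixed, \<open>b\<close> is the smallest value at
      \<open>i\<close> that respects both the obstacle and the inequality centred at
      \<open>i\<close>. Minimality gives \<open>x i = b\<close>, and whichever term attains the
      maximum yields the alternative.\<close>
    define b where "b = max (p i) ((x (i - 1) + x (i + 1) - g i) / 2)"
    have b: "p i \<le> b" "(x (i - 1) + x (i + 1) - g i) / 2 \<le> b"
      by (simp_all add: b_def)
    have "x (i - 1) - 2 * b + x (i + 1) \<le> g i"
      using b(2) by (simp add: divide_le_eq)
    moreover have "b \<le> x i"
      using px[of i] sx[OF that] that by (auto simp: b_def)
    ultimately have "x i \<le> b"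
      using b(1) that by (intro upd) auto
    then show ?thesis
      using px[of i] sx[OF that] that by (auto simp: b_def le_max_iff_disj)
  qed
  ultimately have "solves_obstacle d g p x"
    using px sx by (auto simp: solves_obstacle_def)
  then show ?thesis by blast
qed

section \<open>Nonnegative matrices supported on a monotone chain\<close>

text \<open>Any two positions of the support are comparable in the product order. This is the
  unnormalised comonotone coupling of the row and column marginals.\<close>

definition comonotone :: "nat \<Rightarrow> nat \<Rightarrow> (nat \<Rightarrow> nat \<Rightarrow> real) \<Rightarrow> bool" where
  "comonotone m n u \<longleftrightarrow> (\<forall>i\<le>m. \<forall>j\<le>n. 0 \<le> u i j) \<and>
     (\<forall>i j k l. i < k \<and> k \<le> m \<and> l < j \<and> j \<le> n \<longrightarrow> u i j = 0 \<or> u k l = 0)"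

lemma double_sum_nonzero_obtain:
  fixes f :: "'a \<Rightarrow> 'b \<Rightarrow> real"
  assumes "(\<Sum>i\<in>A. \<Sum>j\<in>B. f i j) \<noteq> 0"
  obtains i j where "i \<in> A" "j \<in> B" "f i j \<noteq> 0"
  using assms by (meson sum.not_neutral_contains_not_neutral)

text \<open>The block to the right of the rectangle and the block below it cannot both contain a
  nonzero entry. So the rectangle carries the whole mass of its rows or of its columns, and the
  other mass is at least as large.\<close>

lemma comonotone_partial_sum:
  assumes u: "comonotone m n u" and "i \<le> Suc m" "j \<le> Suc n"
  shows "(\<Sum>i'<i. \<Sum>j'<j. u i' j') = min (\<Sum>i'<i. \<Sum>j'\<le>n. u i' j') (\<Sum>j'<j. \<Sum>i'\<le>m. u i' j')"
proof -
  define S where "S I J = (\<Sum>i'\<in>I. \<Sum>j'\<in>J. u i' j')" for I J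
  have nonneg: "0 \<le> S I J" if "I \<subseteq> {..m}" "J \<subseteq> {..n}" for I J
    unfolding S_def using that u by (intro sum_nonneg) (auto simp: comonotone_def)
  have n: "{..n} = {..<j} \<union> {j..n}" "{..<j} \<inter> {j..n} = {}"
    and m: "{..m} = {..<i} \<union> {i..m}" "{..<i} \<inter> {i..m} = {}"
    using assms by auto
  have row: "S {..<i} {..n} = S {..<i} {..<j} + S {..<i} {j..n}"
    unfolding S_def n(1) by (subst sum.union_disjoint) (use n in \<open>auto simp: sum.distrib\<close>)
  have col: "S {..m} {..<j} = S {..<i} {..<j} + S {i..m} {..<j}"
    unfolding S_def m(1) by (subst sum.union_disjoint) (use m in auto)
  have "S {..<i} {j..n} = 0 \<or> S {i..m} {..<j} = 0"
  proof (rule ccontr)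
    assume "\<not> ?thesis"
    then obtain i1 j1 i2 j2 where "i1 < i" "j \<le> j1" "j1 \<le> n" "u i1 j1 \<noteq> 0"
      "i \<le> i2" "i2 \<le> m" "j2 < j" "u i2 j2 \<noteq> 0"
      unfolding S_def de_Morgan_disj
      by (elim conjE double_sum_nonzero_obtain) auto
    moreover from this have "i1 < i2" "j2 < j1" by auto
    ultimately show False using u unfolding comonotone_def by blast
  qed
  moreover have "0 \<le> S {..<i} {j..n}" "0 \<le> S {i..m} {..<j}"
    using assms by (auto intro!: nonneg)
  ultimately have "S {..<i} {..<j} = min (S {..<i} {..n}) (S {..m} {..<j})"
    using row col by (auto simp: min_def)
  then show ?thesis
    unfolding S_def by (subst (3) sum.swap) simp
qed

text \<open>An entry is the mixed second difference of the rectangle sums, which depend on the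
  marginals only.\<close>

lemma comonotone_unique:
  assumes u: "comonotone m n u" and v: "comonotone m n v"
    and rows: "\<And>i. i \<le> m \<Longrightarrow> (\<Sum>j\<le>n. u i j) = (\<Sum>j\<le>n. v i j)"
    and cols: "\<And>j. j \<le> n \<Longrightarrow> (\<Sum>i\<le>m. u i j) = (\<Sum>i\<le>m. v i j)"
    and "i \<le> m" "j \<le> n"
  shows "u i j = v i j"
proof -
  define C where "C w i j = (\<Sum>i'<i. \<Sum>j'<j. w i' j')" for w :: "nat \<Rightarrow> nat \<Rightarrow> real" and i j
  have "C u i j = C v i j" if "i \<le> Suc m" "j \<le> Suc n" for i j
    unfolding C_def comonotone_partial_sum[OF u that] comonotone_partial_sum[OF v that]
    using rows cols that by (intro arg_cong2[of _ _ _ _ min]) (rule sum.cong; simp)+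
  then have "C u (Suc i) (Suc j) - C u i (Suc j) - C u (Suc i) j + C u i j =
      C v (Suc i) (Suc j) - C v i (Suc j) - C v (Suc i) j + C v i j"
    using assms(5,6) by simp
  then show ?thesis by (simp add: C_def)
qed

text \<open>Lay the \<open>r i\<close> and the \<open>s j\<close> end to end as intervals on the
  line. The entry \<open>u i j\<close>, defined as the mixed second difference of
  \<open>min (R i) (S j)\<close>, is the length of the overlap of the interval from
  \<open>R i\<close> to \<open>R (Suc i)\<close> with the one from \<open>S j\<close> to
  \<open>S (Suc j)\<close>. Hence it is nonnegative, and two overlaps cannot occur in opposite
  orders.\<close>

lemma comonotone_exists:
  fixes r s :: "nat \<Rightarrow> real"
  assumes r: "\<And>i. i \<le> m \<Longrightarrow> 0 \<le> r i" and s: "\<And>j. j \<le> n \<Longrightarrow> 0 \<le> s j"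
    and total: "(\<Sum>i\<le>m. r i) = (\<Sum>j\<le>n. s j)"
  obtains u where "comonotone m n u" "\<And>i. i \<le> m \<Longrightarrow> (\<Sum>j\<le>n. u i j) = r i"
    "\<And>j. j \<le> n \<Longrightarrow> (\<Sum>i\<le>m. u i j) = s j"
proof -
  define R where "R i = (\<Sum>i'<i. r i')" for i
  define S where "S j = (\<Sum>j'<j. s j')" for j
  define C where "C i j = min (R i) (S j)" for i j
  define u where "u i j = C (Suc i) (Suc j) - C i (Suc j) - C (Suc i) j + C i j" for i j
  have R: "R i \<le> R k" if "i \<le> k" "k \<le> Suc m" for i k
    unfolding R_def using that r by (intro sum_mono2) auto
  have S: "S i \<le> S k" if "i \<le> k" "k \<le> Suc n" for i k
    unfolding S_def using that s by (intro sum_mono2) auto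
  have eq: "R (Suc m) = S (Suc n)"
    using total by (simp add: R_def S_def lessThan_Suc_atMost)
  have [simp]: "R 0 = 0" "S 0 = 0" by (auto simp: R_def S_def)
  have Rs: "R (Suc i) = R i + r i" and Ss: "S (Suc i) = S i + s i" for i
    by (auto simp: R_def S_def)
  have "comonotone m n u"
    unfolding comonotone_def
  proof (intro conjI allI impI)
    fix i j assume "i \<le> m" "j \<le> n"
    then show "0 \<le> u i j"
      using R[of i "Suc i"] S[of j "Suc j"] by (auto simp: u_def C_def min_def)
  next
    fix i j k l assume a: "i < k \<and> k \<le> m \<and> l < j \<and> j \<le> n"
    then have "R (Suc i) \<le> R k" "S (Suc l) \<le> S j" "R i \<le> R (Suc i)" "R k \<le> R (Suc k)"
      "S l \<le> S (Suc l)" "S j \<le> S (Suc j)"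
      by (auto intro!: R S)
    then show "u i j = 0 \<or> u k l = 0"
      by (auto simp: u_def C_def min_def)
  qed
  moreover have "(\<Sum>j\<le>n. u i j) = r i" if "i \<le> m" for i
  proof -
    \<comment> \<open>The row sum telescopes. At \<open>k = Suc n\<close> equality of the totals
      makes \<open>S (Suc n)\<close> at least every \<open>R\<close>, so that \<open>C\<close>
      reduces to \<open>R\<close>.\<close>
    have "(\<Sum>j<k. u i j) = C (Suc i) k - C i k - C (Suc i) 0 + C i 0" for k
      by (induction k) (auto simp: u_def)
    from this[of "Suc n"] show ?thesis
      using that R[of i "Suc m"] R[of "Suc i" "Suc m"] R[of 0 i] R[of 0 "Suc i"] eq
      by (simp add: C_def lessThan_Suc_atMost Rs)
  qed
  moreover have "(\<Sum>i\<le>m. u i j) = s j" if "j \<le> n" for j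
  proof -
    have "(\<Sum>i<k. u i j) = C k (Suc j) - C k j - C 0 (Suc j) + C 0 j" for k
      by (induction k) (auto simp: u_def)
    from this[of "Suc m"] show ?thesis
      using that S[of j "Suc n"] S[of "Suc j" "Suc n"] S[of 0 j] S[of 0 "Suc j"] eq
      by (simp add: C_def lessThan_Suc_atMost Ss)
  qed
  ultimately show thesis by (rule that)
qed

section \<open>Chain matrices with vanishing corners and partly prescribed marginals\<close>

text \<open>This is what the rows \<open>G1\<close>, \<open>G2\<close> and \<open>G\<close> say
  about \<open>u\<close>: the first two prescribe only inner marginals, the last only the difference
  of the first column sum and the first row sum. The two corners have no column label.\<close>

definition corner_coupling ::
    "nat \<Rightarrow> nat \<Rightarrow> (nat \<Rightarrow> real) \<Rightarrow> (nat \<Rightarrow> real) \<Rightarrow> real \<Rightarrow> (nat \<Rightarrow> nat \<Rightarrow> real) \<Rightarrow> bool" where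
  "corner_coupling m n r s c u \<longleftrightarrow> comonotone m n u \<and> u 0 0 = 0 \<and> u m n = 0 \<and>
     (\<forall>i\<in>{1..<m}. (\<Sum>j\<le>n. u i j) = r i) \<and> (\<forall>j\<in>{1..<n}. (\<Sum>i\<le>m. u i j) = s j) \<and>
     (\<Sum>i\<le>m. u i 0) - (\<Sum>j\<le>n. u 0 j) = c"

lemma sum_first_last:
  fixes f :: "nat \<Rightarrow> real"
  assumes "0 < m"
  shows "(\<Sum>i\<le>m. f i) = f 0 + (\<Sum>i\<in>{1..<m}. f i) + f m"
proof -
  have "{..m} = insert 0 (insert m {1..<m})" using assms by auto
  then show ?thesis using assms by simp
qed

text \<open>
  The vanishing corner entries force the border row or the border column through each corner
  to vanish, so the missing marginals are the positive and negative parts of their difference.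
\<close>

lemma corner_coupling_margins:
  assumes mn: "0 < m" "0 < n" and u: "corner_coupling m n r s c u"
  defines "e \<equiv> c + (\<Sum>j\<in>{1..<n}. s j) - (\<Sum>i\<in>{1..<m}. r i)"
  shows "(\<Sum>j\<le>n. u 0 j) = max 0 (- c)" "(\<Sum>i\<le>m. u i 0) = max 0 c"
    "(\<Sum>j\<le>n. u m j) = max 0 e" "(\<Sum>i\<le>m. u i n) = max 0 (- e)"
proof -
  have co: "comonotone m n u" and z: "u 0 0 = 0" "u m n = 0"
    and c: "(\<Sum>i\<le>m. u i 0) - (\<Sum>j\<le>n. u 0 j) = c"
    using u by (auto simp: corner_coupling_def)
  have nn: "0 \<le> (\<Sum>j\<le>n. u 0 j)" "0 \<le> (\<Sum>i\<le>m. u i 0)" "0 \<le> (\<Sum>j\<le>n. u m j)" "0 \<le> (\<Sum>i\<le>m. u i n)"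
    using co by (auto intro!: sum_nonneg simp: comonotone_def)
  have "(\<Sum>j\<le>n. u 0 j) = 0 \<or> (\<Sum>i\<le>m. u i 0) = 0"
  proof (rule ccontr)
    assume "\<not> ?thesis"
    then obtain i j where "i \<le> m" "j \<le> n" "u 0 j \<noteq> 0" "u i 0 \<noteq> 0"
      by (metis atMost_iff sum.neutral)
    moreover from this have "0 < i" "0 < j" using z by (metis gr0I)+
    ultimately show False using co mn unfolding comonotone_def by blast
  qed
  then show "(\<Sum>j\<le>n. u 0 j) = max 0 (- c)" "(\<Sum>i\<le>m. u i 0) = max 0 c"
    using c nn by (auto simp: max_def)
  have "(\<Sum>j\<le>n. u m j) = 0 \<or> (\<Sum>i\<le>m. u i n) = 0"
  proof (rule ccontr)
    assume "\<not> ?thesis"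
    then obtain i j where "i \<le> m" "j \<le> n" "u m j \<noteq> 0" "u i n \<noteq> 0"
      by (metis atMost_iff sum.neutral)
    moreover from this have "i < m" "j < n" using z by (metis le_neq_implies_less)+
    ultimately show False using co mn unfolding comonotone_def by blast
  qed
  \<comment> \<open>Counting the total by rows and by columns leaves \<open>e\<close> as the
    difference of the last row sum and the last column sum.\<close>
  moreover have "(\<Sum>i\<le>m. \<Sum>j\<le>n. u i j) = (\<Sum>j\<le>n. \<Sum>i\<le>m. u i j)"
    by (rule sum.swap)
  then have "(\<Sum>j\<le>n. u m j) - (\<Sum>i\<le>m. u i n) = e"
    unfolding sum_first_last[OF mn(1), of "\<lambda>i. \<Sum>j\<le>n. u i j"]
      sum_first_last[OF mn(2), of "\<lambda>j. \<Sum>i\<le>m. u i j"]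
    using u c by (simp add: corner_coupling_def e_def)
  ultimately show "(\<Sum>j\<le>n. u m j) = max 0 e" "(\<Sum>i\<le>m. u i n) = max 0 (- e)"
    using nn by (auto simp: max_def)
qed

lemma corner_coupling_cong:
  assumes "corner_coupling m n r s c u"
    and "\<And>i. i \<in> {1..<m} \<Longrightarrow> r i = r' i" "\<And>j. j \<in> {1..<n} \<Longrightarrow> s j = s' j" "c = c'"
  shows "corner_coupling m n r' s' c' u"
  using assms by (simp add: corner_coupling_def)

lemma corner_coupling_unique:
  assumes mn: "0 < m" "0 < n" and u: "corner_coupling m n r s c u" and v: "corner_coupling m n r s c v"
    and "i \<le> m" "j \<le> n"
  shows "u i j = v i j"
proof (rule comonotone_unique[of m n])
  fix i assume "i \<le> m"
  then consider "i = 0" | "i = m" | "i \<in> {1..<m}" by force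
  then show "(\<Sum>j\<le>n. u i j) = (\<Sum>j\<le>n. v i j)"
    by cases (use corner_coupling_margins[OF mn u] corner_coupling_margins[OF mn v] u v
      in \<open>auto simp: corner_coupling_def\<close>)
next
  fix j assume "j \<le> n"
  then consider "j = 0" | "j = n" | "j \<in> {1..<n}" by force
  then show "(\<Sum>i\<le>m. u i j) = (\<Sum>i\<le>m. v i j)"
    by cases (use corner_coupling_margins[OF mn u] corner_coupling_margins[OF mn v] u v
      in \<open>auto simp: corner_coupling_def\<close>)
qed (use assms in \<open>auto simp: corner_coupling_def\<close>)

text \<open>Complete the marginals by the values forced in \<open>corner_coupling_margins\<close>;
  \<open>e\<close> is chosen so that the totals agree. At each corner one of the two adjacent border
  marginals is zero and bounds the corner entry.\<close>

lemma corner_coupling_exists: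
  assumes mn: "0 < m" "0 < n"
    and r: "\<And>i. i \<in> {1..<m} \<Longrightarrow> 0 \<le> r i" and s: "\<And>j. j \<in> {1..<n} \<Longrightarrow> 0 \<le> s j"
  shows "\<exists>u. corner_coupling m n r s c u"
proof -
  define e where "e = c + (\<Sum>j\<in>{1..<n}. s j) - (\<Sum>i\<in>{1..<m}. r i)"
  define r' where "r' i = (if i = 0 then max 0 (- c) else if i = m then max 0 e else r i)" for i
  define s' where "s' j = (if j = 0 then max 0 c else if j = n then max 0 (- e) else s j)" for j
  have "(\<Sum>i\<in>{1..<m}. r' i) = (\<Sum>i\<in>{1..<m}. r i)" "(\<Sum>j\<in>{1..<n}. s' j) = (\<Sum>j\<in>{1..<n}. s j)"
    by (auto simp: r'_def s'_def intro!: sum.cong)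
  then have "(\<Sum>i\<le>m. r' i) = (\<Sum>j\<le>n. s' j)"
    unfolding sum_first_last[OF mn(1)] sum_first_last[OF mn(2)]
    using mn by (auto simp: r'_def s'_def e_def max_def)
  moreover have "0 \<le> r' i" if "i \<le> m" for i using that r by (auto simp: r'_def)
  moreover have "0 \<le> s' j" if "j \<le> n" for j using that s by (auto simp: s'_def)
  ultimately obtain u where u: "comonotone m n u" and R: "\<And>i. i \<le> m \<Longrightarrow> (\<Sum>j\<le>n. u i j) = r' i"
    and S: "\<And>j. j \<le> n \<Longrightarrow> (\<Sum>i\<le>m. u i j) = s' j"
    using comonotone_exists by metis
  have entry: "u i j \<le> r' i" "u i j \<le> s' j" "0 \<le> u i j" if "i \<le> m" "j \<le> n" for i j
    using that u member_le_sum[of j "{..n}" "u i"] member_le_sum[of i "{..m}" "\<lambda>i. u i j"]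
    by (auto simp: R[symmetric] S[symmetric] comonotone_def)
  have "u 0 0 = 0" "u m n = 0"
    using entry[of 0 0] entry[of m n] mn by (auto simp: r'_def s'_def max_def split: if_splits)
  then have "corner_coupling m n r s c u"
    using u mn R[of 0] S[of 0] by (auto simp: corner_coupling_def R S r'_def s'_def)
  then show ?thesis by blast
qed

section \<open>The linear system read row by row\<close>

text \<open>The condition is stated for families indexed by labels; injectivity of
  \<open>vertex\<close> later transfers it to families indexed by vectors.\<close>

definition mv_solution ::
    "nat \<Rightarrow> nat \<Rightarrow> (row_label \<Rightarrow> real) \<Rightarrow> (col_label \<Rightarrow> real) \<Rightarrow> bool" where
  "mv_solution d1 d2 \<beta> f \<longleftrightarrow>
     \<beta> = (\<lambda>x. \<Sum>c\<in>col_labels d1 d2. f c * vertex d1 d2 c x) \<and>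
     (\<forall>P\<in>label_Pi d1 d2. Min (f ` P) = 0)"

text \<open>Padding the two missing corners with zero lets all sums run over a full
  rectangle.\<close>

definition u_matrix :: "nat \<Rightarrow> nat \<Rightarrow> (col_label \<Rightarrow> real) \<Rightarrow> nat \<Rightarrow> nat \<Rightarrow> real" where
  "u_matrix d1 d2 f i j = (if (i, j) = (0, 0) \<or> (i, j) = (d1, d2) then 0 else f (U i j))"

lemma finite_col_labels: "finite (col_labels d1 d2)"
  by (simp add: col_labels_def finite_u_indices)

lemma col_labels_iff:
  "A1 i \<in> col_labels d1 d2 \<longleftrightarrow> i \<le> d1" "A2 i \<in> col_labels d1 d2 \<longleftrightarrow> i \<le> d1"
  "B1 j \<in> col_labels d1 d2 \<longleftrightarrow> j \<le> d2" "B2 j \<in> col_labels d1 d2 \<longleftrightarrow> j \<le> d2"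
  "U i j \<in> col_labels d1 d2 \<longleftrightarrow>
     i \<le> d1 \<and> j \<le> d2 \<and> (i, j) \<noteq> (0, 0) \<and> (i, j) \<noteq> (d1, d2)"
proof -
  have "U i j \<in> case_prod U ` I \<longleftrightarrow> (i, j) \<in> I" for I
    by force
  then show "U i j \<in> col_labels d1 d2 \<longleftrightarrow>
     i \<le> d1 \<and> j \<le> d2 \<and> (i, j) \<noteq> (0, 0) \<and> (i, j) \<noteq> (d1, d2)"
    unfolding col_labels_def by (auto simp: u_indices_def)
qed (auto simp: col_labels_def)

lemma sum_col_labels:
  fixes F :: "col_label \<Rightarrow> real"
  shows "(\<Sum>c\<in>col_labels d1 d2. F c) = (\<Sum>i\<le>d1. F (A1 i)) + (\<Sum>i\<le>d1. F (A2 i)) +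
    (\<Sum>j\<le>d2. F (B1 j)) + (\<Sum>j\<le>d2. F (B2 j)) + (\<Sum>i\<le>d1. \<Sum>j\<le>d2. u_matrix d1 d2 F i j)"
proof -
  have "(\<Sum>c\<in>case_prod U ` u_indices d1 d2. F c) = (\<Sum>(i, j)\<in>u_indices d1 d2. F (U i j))"
    by (subst sum.reindex) (auto simp: inj_on_def o_def split_def)
  also have "\<dots> = (\<Sum>(i, j)\<in>{..d1} \<times> {..d2}. u_matrix d1 d2 F i j)"
    by (rule sum.mono_neutral_cong_left) (auto simp: u_indices_def u_matrix_def split: if_splits)
  also have "\<dots> = (\<Sum>i\<le>d1. \<Sum>j\<le>d2. u_matrix d1 d2 F i j)"
    by (simp add: sum.cartesian_product)
  finally have U: "(\<Sum>c\<in>case_prod U ` u_indices d1 d2. F c) = \<dots>" .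
  have "(\<Sum>c\<in>col_labels d1 d2. F c) = sum F (A1 ` {0..d1}) + sum F (A2 ` {0..d1}) +
      sum F (B1 ` {0..d2}) + sum F (B2 ` {0..d2}) + sum F (case_prod U ` u_indices d1 d2)"
    unfolding col_labels_def
    by (subst sum.union_disjoint; (auto simp: finite_u_indices)?)+
  then show ?thesis
    unfolding U by (simp add: sum.reindex inj_on_def atMost_atLeast0)
qed

lemma sum_of_bool_atMost:
  fixes g :: "nat \<Rightarrow> real"
  assumes "a \<le> d"
  shows "(\<Sum>i\<le>d. g i * of_bool (i = a)) = g a"
  using assms by (simp add: of_bool_def if_distrib cong: if_cong)

lemma vertex_Z:
  "vertex d1 d2 (A1 i) (Z k) = of_bool (i = k)" "vertex d1 d2 (A2 i) (Z k) = - of_bool (i = k)"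
  "vertex d1 d2 (B1 i) (Z k) = 0" "vertex d1 d2 (B2 i) (Z k) = 0" "vertex d1 d2 (U i j) (Z k) = 0"
  unfolding vertex_def vertex_column_A_B vertex_column_U by auto

lemma vertex_W:
  "vertex d1 d2 (A1 i) (W k) = 0" "vertex d1 d2 (A2 i) (W k) = 0"
  "vertex d1 d2 (B1 i) (W k) = of_bool (i = k)" "vertex d1 d2 (B2 i) (W k) = - of_bool (i = k)"
  "vertex d1 d2 (U i j) (W k) = 0"
  unfolding vertex_def vertex_column_A_B vertex_column_U by auto

lemma vertex_G1:
  assumes "k \<in> {1..<d1}"
  shows "vertex d1 d2 (A1 i) (G1 k) = 0"
    "vertex d1 d2 (A2 i) (G1 k) = of_bool (i = k - 1) - 2 * of_bool (i = k) + of_bool (i = k + 1)"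
    "vertex d1 d2 (B1 i) (G1 k) = 0" "vertex d1 d2 (B2 i) (G1 k) = 0"
    "vertex d1 d2 (U i j) (G1 k) = of_bool (i = k)"
proof -
  have eps: "eps_G1 d1 m (G1 k) = of_bool (m = k)"
    "eps_G2 d2 m (G1 k) = 0" for m
    using assms by (auto simp: eps_G1_def eps_G2_def eps_def)
  \<comment> \<open>Since \<open>1 \<le> k\<close>, truncated subtraction does no harm:
    \<open>i = 0\<close> gives \<open>i - 1 = 0\<close>, which differs from
    \<open>k\<close>.\<close>
  have "i - 1 = k \<longleftrightarrow> i = k + 1" "i + 1 = k \<longleftrightarrow> i = k - 1"
    using assms by auto
  then show "vertex d1 d2 (A2 i) (G1 k) =
      of_bool (i = k - 1) - 2 * of_bool (i = k) + of_bool (i = k + 1)"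
    by (simp add: vertex_def eps eps_def)
  show "vertex d1 d2 (A1 i) (G1 k) = 0" "vertex d1 d2 (B1 i) (G1 k) = 0"
    "vertex d1 d2 (B2 i) (G1 k) = 0"
    by (simp_all add: vertex_def eps eps_def)
  show "vertex d1 d2 (U i j) (G1 k) = of_bool (i = k)"
    using assms by (auto simp: vertex_def eps eps_def)
qed

lemma vertex_G2:
  assumes "k \<in> {1..<d2}"
  shows "vertex d1 d2 (A1 i) (G2 k) = 0" "vertex d1 d2 (A2 i) (G2 k) = 0"
    "vertex d1 d2 (B1 i) (G2 k) = 0"
    "vertex d1 d2 (B2 i) (G2 k) = of_bool (i = k - 1) - 2 * of_bool (i = k) + of_bool (i = k + 1)"
    "vertex d1 d2 (U i j) (G2 k) = of_bool (j = k)"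
proof -
  have eps: "eps_G1 d1 m (G2 k) = 0"
    "eps_G2 d2 m (G2 k) = of_bool (m = k)" for m
    using assms by (auto simp: eps_G1_def eps_G2_def eps_def)
  have "i - 1 = k \<longleftrightarrow> i = k + 1" "i + 1 = k \<longleftrightarrow> i = k - 1"
    using assms by auto
  then show "vertex d1 d2 (B2 i) (G2 k) =
      of_bool (i = k - 1) - 2 * of_bool (i = k) + of_bool (i = k + 1)"
    by (simp add: vertex_def eps eps_def)
  show "vertex d1 d2 (A1 i) (G2 k) = 0" "vertex d1 d2 (B1 i) (G2 k) = 0"
    "vertex d1 d2 (A2 i) (G2 k) = 0"
    by (simp_all add: vertex_def eps eps_def)
  show "vertex d1 d2 (U i j) (G2 k) = of_bool (j = k)"
    using assms by (auto simp: vertex_def eps eps_def)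
qed

text \<open>The pair \<open>(0, 0)\<close> is excluded because there \<open>vertex_column\<close>
  yields -1, whereas the difference of indicators is 0.\<close>

lemma vertex_G:
  "vertex d1 d2 (A1 i) G = 0" "vertex d1 d2 (A2 i) G = of_bool (i = 0) - of_bool (i = 1)"
  "vertex d1 d2 (B1 i) G = 0" "vertex d1 d2 (B2 i) G = of_bool (i = 1) - of_bool (i = 0)"
  "(i, j) \<noteq> (0, 0) \<Longrightarrow> vertex d1 d2 (U i j) G = of_bool (j = 0) - of_bool (i = 0)"
  by (simp_all add: vertex_def eps_def eps_G1_def eps_G2_def) auto

text \<open>The pattern 1, -2, 1 is symmetric, so reading the columns \<open>A2\<close> and
  \<open>B2\<close> by rows again produces second differences.\<close>

lemma row_sums:
  fixes f :: "col_label \<Rightarrow> real"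
  assumes d: "0 < d1" "0 < d2"
  defines "S \<equiv> \<lambda>x. \<Sum>c\<in>col_labels d1 d2. f c * vertex d1 d2 c x" and "u \<equiv> u_matrix d1 d2 f"
  shows "k \<le> d1 \<Longrightarrow> S (Z k) = f (A1 k) - f (A2 k)"
    "k \<le> d2 \<Longrightarrow> S (W k) = f (B1 k) - f (B2 k)"
    "k \<in> {1..<d1} \<Longrightarrow>
       S (G1 k) = f (A2 (k - 1)) - 2 * f (A2 k) + f (A2 (k + 1)) + (\<Sum>j\<le>d2. u k j)"
    "k \<in> {1..<d2} \<Longrightarrow>
       S (G2 k) = f (B2 (k - 1)) - 2 * f (B2 k) + f (B2 (k + 1)) + (\<Sum>i\<le>d1. u i k)"
    "S G = f (A2 0) - f (A2 1) - f (B2 0) + f (B2 1) + (\<Sum>i\<le>d1. u i 0) - (\<Sum>j\<le>d2. u 0 j)"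
    "x \<notin> row_labels d1 d2 \<Longrightarrow> S x = 0"
proof -
  have U: "u_matrix d1 d2 (\<lambda>c. f c * vertex d1 d2 c x) i j = u i j * vertex d1 d2 (U i j) x" for i j x
    by (simp add: u_matrix_def u_def)
  note S = S_def sum_col_labels U
  have row: "(\<Sum>i\<le>d1. \<Sum>j\<le>d2. u i j * of_bool (i = k)) = (\<Sum>j\<le>d2. u k j)" if "k \<le> d1" for k
    using sum_of_bool_atMost[OF that, of "\<lambda>i. \<Sum>j\<le>d2. u i j"] by (simp add: sum_distrib_right)
  have col: "(\<Sum>i\<le>d1. \<Sum>j\<le>d2. u i j * of_bool (j = k)) = (\<Sum>i\<le>d1. u i k)" if "k \<le> d2" for k
    using that by (simp only: sum_of_bool_atMost)
  show "S (Z k) = f (A1 k) - f (A2 k)" if "k \<le> d1"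
    using that unfolding S vertex_Z by (simp add: sum_of_bool_atMost sum_negf)
  show "S (W k) = f (B1 k) - f (B2 k)" if "k \<le> d2"
    using that unfolding S vertex_W by (simp add: sum_of_bool_atMost sum_negf)
  have second_diff: "(\<Sum>i\<le>d. g i * (of_bool (i = k - 1) - 2 * of_bool (i = k) + of_bool (i = k + 1))) =
      g (k - 1) - 2 * g k + g (k + 1)" if "k \<in> {1..<d}" for g :: "nat \<Rightarrow> real" and k d
  proof -
    have "(\<Sum>i\<le>d. g i * (of_bool (i = k - 1) - 2 * of_bool (i = k) + of_bool (i = k + 1))) =
        (\<Sum>i\<le>d. g i * of_bool (i = k - 1)) - 2 * (\<Sum>i\<le>d. g i * of_bool (i = k)) +
        (\<Sum>i\<le>d. g i * of_bool (i = k + 1))"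
      unfolding sum_distrib_left sum.distrib[symmetric] sum_subtractf[symmetric]
      by (intro sum.cong) (auto simp: algebra_simps)
    also have "\<dots> = g (k - 1) - 2 * g k + g (k + 1)"
      using that by (subst (1 2 3) sum_of_bool_atMost) auto
    finally show ?thesis .
  qed
  have first_diff: "(\<Sum>i\<le>d. g i * (of_bool (i = a) - of_bool (i = b))) = g a - g b"
    if "a \<le> d" "b \<le> d" for g :: "nat \<Rightarrow> real" and a b d
    using that by (simp only: right_diff_distrib sum_subtractf sum_of_bool_atMost)
  show "S (G1 k) = f (A2 (k - 1)) - 2 * f (A2 k) + f (A2 (k + 1)) + (\<Sum>j\<le>d2. u k j)"
    if k: "k \<in> {1..<d1}"
    using k row[of k] unfolding S vertex_G1[OF k] second_diff[OF k] by (simp del: sum_mult_of_bool_eq)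
  show "S (G2 k) = f (B2 (k - 1)) - 2 * f (B2 k) + f (B2 (k + 1)) + (\<Sum>i\<le>d1. u i k)"
    if k: "k \<in> {1..<d2}"
    using k col[of k] unfolding S vertex_G2[OF k] second_diff[OF k] by (simp del: sum_mult_of_bool_eq)
  \<comment> \<open>At \<open>(0, 0)\<close> the formula for the row \<open>G\<close> fails, but
    \<open>u\<close> vanishes there.\<close>
  have "u i j * vertex d1 d2 (U i j) G = u i j * of_bool (j = 0) - u i j * of_bool (i = 0)" for i j
    by (cases "(i, j) = (0, 0)") (auto simp: vertex_G(5) u_def u_matrix_def right_diff_distrib)
  then have "(\<Sum>i\<le>d1. \<Sum>j\<le>d2. u i j * vertex d1 d2 (U i j) G) = (\<Sum>i\<le>d1. u i 0) - (\<Sum>j\<le>d2. u 0 j)"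
    by (simp only: sum_subtractf row col zero_le)
  then show "S G = f (A2 0) - f (A2 1) - f (B2 0) + f (B2 1) + (\<Sum>i\<le>d1. u i 0) - (\<Sum>j\<le>d2. u 0 j)"
    unfolding S vertex_G(1-4) using d by (simp add: first_diff)
  show "S x = 0" if "x \<notin> row_labels d1 d2"
    using that vertex_in_coord_space[of _ d1 d2] unfolding S_def coord_space_def
    by (intro sum.neutral) auto
qed

text \<open>The sets in \<open>label_Pi\<close> cover all labels, so nonnegativity on each of them
  is nonnegativity everywhere.\<close>

lemma Min_label_Pi_iff:
  fixes f :: "col_label \<Rightarrow> real"
  assumes "0 < d1" "0 < d2"
  shows "(\<forall>P\<in>label_Pi d1 d2. Min (f ` P) = 0) \<longleftrightarrow>
    (\<forall>c\<in>col_labels d1 d2. 0 \<le> f c) \<and> (\<forall>P\<in>label_Pi d1 d2. \<exists>c\<in>P. f c = 0)"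
proof -
  have "Min (f ` P) = 0 \<longleftrightarrow> (\<forall>c\<in>P. 0 \<le> f c) \<and> (\<exists>c\<in>P. f c = 0)" if "P \<in> label_Pi d1 d2" for P
  proof -
    have "P \<noteq> {}" using that by (auto simp: label_Pi_def)
    moreover have "finite P"
      using that Union_label_Pi[OF assms] finite_col_labels by (metis Sup_upper finite_subset)
    ultimately show ?thesis by (subst Min_eq_iff) auto
  qed
  then show ?thesis
    unfolding Union_label_Pi[OF assms, symmetric] by blast
qed

section \<open>Reduction to obstacle problems and a corner coupling\<close>

text \<open>The obstacle \<open>max 0 (- \<beta> (Z i))\<close> combines nonnegativity of
  \<open>f (A2 i)\<close> with that of \<open>f (A1 i) = f (A2 i) + \<beta> (Z i)\<close>; contact
  means that one of the two vanishes. The \<open>W\<close> rows behave alike.\<close>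

lemma mv_solution_iff:
  assumes d: "0 < d1" "0 < d2" and \<beta>: "\<beta> \<in> coord_space (row_labels d1 d2)"
  shows "mv_solution d1 d2 \<beta> f \<longleftrightarrow>
    (\<forall>i\<le>d1. f (A1 i) = f (A2 i) + \<beta> (Z i)) \<and> (\<forall>j\<le>d2. f (B1 j) = f (B2 j) + \<beta> (W j)) \<and>
    solves_obstacle d1 (\<lambda>i. \<beta> (G1 i)) (\<lambda>i. max 0 (- \<beta> (Z i))) (\<lambda>i. f (A2 i)) \<and>
    solves_obstacle d2 (\<lambda>j. \<beta> (G2 j)) (\<lambda>j. max 0 (- \<beta> (W j))) (\<lambda>j. f (B2 j)) \<and>
    corner_coupling d1 d2
      (\<lambda>i. \<beta> (G1 i) - (f (A2 (i - 1)) - 2 * f (A2 i) + f (A2 (i + 1))))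
      (\<lambda>j. \<beta> (G2 j) - (f (B2 (j - 1)) - 2 * f (B2 j) + f (B2 (j + 1))))
      (\<beta> G - (f (A2 0) - f (A2 1) - f (B2 0) + f (B2 1))) (u_matrix d1 d2 f)"
    (is "_ \<longleftrightarrow> ?A \<and> ?B \<and> ?oA \<and> ?oB \<and> ?C")
proof
  assume "mv_solution d1 d2 \<beta> f"
  then have S: "\<And>x. \<beta> x = (\<Sum>c\<in>col_labels d1 d2. f c * vertex d1 d2 c x)"
    and nn: "\<And>c. c \<in> col_labels d1 d2 \<Longrightarrow> 0 \<le> f c"
    and z: "\<And>P. P \<in> label_Pi d1 d2 \<Longrightarrow> \<exists>c\<in>P. f c = 0"
    by (auto simp: mv_solution_def Min_label_Pi_iff[OF d])
  note rows = row_sums[OF d, where f = f, folded S]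
  have nnA: "0 \<le> f (A1 i)" "0 \<le> f (A2 i)" if "i \<le> d1" for i
    using that by (auto intro!: nn simp: col_labels_iff)
  have nnB: "0 \<le> f (B1 i)" "0 \<le> f (B2 i)" if "i \<le> d2" for i
    using that by (auto intro!: nn simp: col_labels_iff)
  have nnU: "0 \<le> u_matrix d1 d2 f i j" if "i \<le> d1" "j \<le> d2" for i j
    using that by (auto intro!: nn simp: col_labels_iff u_matrix_def)
  have A: ?A and B: ?B
    using rows(1,2) by auto
  have A0: "f (A1 i) = 0 \<or> f (A2 i) = 0" if "i = 0 \<or> i = d1" for i
    using z[of "{A1 i, A2 i}"] that by (auto simp: label_Pi_def)
  have B0: "f (B1 i) = 0 \<or> f (B2 i) = 0" if "i = 0 \<or> i = d2" for i
    using z[of "{B1 i, B2 i}"] that by (auto simp: label_Pi_def)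
  \<comment> \<open>Each \<open>j\<close> contributes one set with the same \<open>A1 i\<close> and
    \<open>A2 i\<close>. If both coefficients are nonzero, every entry of row \<open>i\<close>
    vanishes, and with them the row sum.\<close>
  have AU: "f (A1 i) = 0 \<or> f (A2 i) = 0 \<or> (\<Sum>j\<le>d2. u_matrix d1 d2 f i j) = 0"
    if "i \<in> {1..<d1}" for i
  proof -
    have "f (A1 i) = 0 \<or> f (A2 i) = 0 \<or> u_matrix d1 d2 f i j = 0" if "j \<le> d2" for j
      using z[OF label_Pi_I(1)[of i d1 j d2]] that \<open>i \<in> {1..<d1}\<close> by (auto simp: u_matrix_def)
    then show ?thesis by (meson atMost_iff sum.neutral)
  qed
  have BU: "f (B1 j) = 0 \<or> f (B2 j) = 0 \<or> (\<Sum>i\<le>d1. u_matrix d1 d2 f i j) = 0"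
    if "j \<in> {1..<d2}" for j
  proof -
    have "f (B1 j) = 0 \<or> f (B2 j) = 0 \<or> u_matrix d1 d2 f i j = 0" if "i \<le> d1" for i
      using z[OF label_Pi_I(2)[of j d2 i d1]] that \<open>j \<in> {1..<d2}\<close> by (auto simp: u_matrix_def)
    then show ?thesis by (meson atMost_iff sum.neutral)
  qed
  have oA: ?oA
    unfolding solves_obstacle_def
  proof (intro conjI ballI allI impI)
    fix i assume i: "i \<in> {1..<d1}"
    have "0 \<le> (\<Sum>j\<le>d2. u_matrix d1 d2 f i j)"
      using i nnU by (intro sum_nonneg) auto
    then show "f (A2 (i - 1)) - 2 * f (A2 i) + f (A2 (i + 1)) \<le> \<beta> (G1 i)"
      using rows(3)[OF i] by simp
    show "f (A2 i) = max 0 (- \<beta> (Z i)) \<or>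
        f (A2 (i - 1)) - 2 * f (A2 i) + f (A2 (i + 1)) = \<beta> (G1 i)"
      using AU[OF i] rows(3)[OF i] A nnA[of i] i by (auto simp: max_def)
  qed (use A A0[of 0] A0[of d1] nnA in \<open>force simp: max_def\<close>)+
  have oB: ?oB
    unfolding solves_obstacle_def
  proof (intro conjI ballI allI impI)
    fix j assume j: "j \<in> {1..<d2}"
    have "0 \<le> (\<Sum>i\<le>d1. u_matrix d1 d2 f i j)"
      using j nnU by (intro sum_nonneg) auto
    then show "f (B2 (j - 1)) - 2 * f (B2 j) + f (B2 (j + 1)) \<le> \<beta> (G2 j)"
      using rows(4)[OF j] by simp
    show "f (B2 j) = max 0 (- \<beta> (W j)) \<or>
        f (B2 (j - 1)) - 2 * f (B2 j) + f (B2 (j + 1)) = \<beta> (G2 j)"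
      using BU[OF j] rows(4)[OF j] B nnB[of j] j by (auto simp: max_def)
  qed (use B B0[of 0] B0[of d2] nnB in \<open>force simp: max_def\<close>)+
  have "u_matrix d1 d2 f i j = 0 \<or> u_matrix d1 d2 f k l = 0"
    if "i < k" "k \<le> d1" "l < j" "j \<le> d2" for i j k l
    using z[OF label_Pi_I(3)[OF that]] by (auto simp: u_matrix_def)
  then have "comonotone d1 d2 (u_matrix d1 d2 f)"
    using nnU unfolding comonotone_def by blast
  then have ?C
    using rows(3-5) by (auto simp: corner_coupling_def u_matrix_def[of d1 d2 f 0 0] u_matrix_def[of d1 d2 f d1 d2])
  with A B oA oB show "?A \<and> ?B \<and> ?oA \<and> ?oB \<and> ?C" by blast
next
  assume "?A \<and> ?B \<and> ?oA \<and> ?oB \<and> ?C"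
  then have A: ?A and B: ?B and oA: ?oA and oB: ?oB and C: ?C by blast+
  note rows = row_sums[OF d, where f = f]
  let ?u = "u_matrix d1 d2 f"
  have co: "comonotone d1 d2 ?u" and
    r: "\<And>i. i \<in> {1..<d1} \<Longrightarrow> (\<Sum>j\<le>d2. ?u i j) = \<beta> (G1 i) - (f (A2 (i - 1)) - 2 * f (A2 i) + f (A2 (i + 1)))" and
    s: "\<And>j. j \<in> {1..<d2} \<Longrightarrow> (\<Sum>i\<le>d1. ?u i j) = \<beta> (G2 j) - (f (B2 (j - 1)) - 2 * f (B2 j) + f (B2 (j + 1)))" and
    g: "(\<Sum>i\<le>d1. ?u i 0) - (\<Sum>j\<le>d2. ?u 0 j) = \<beta> G - (f (A2 0) - f (A2 1) - f (B2 0) + f (B2 1))"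
    using C unfolding corner_coupling_def by blast+
  have lin: "\<beta> x = (\<Sum>c\<in>col_labels d1 d2. f c * vertex d1 d2 c x)" for x
  proof (cases "x \<in> row_labels d1 d2")
    case True
    then consider k where "x = Z k" "k \<le> d1" | k where "x = W k" "k \<le> d2"
      | k where "x = G1 k" "k \<in> {1..<d1}" | "x = G" | k where "x = G2 k" "k \<in> {1..<d2}"
      by (auto simp: row_labels_def)
    then show ?thesis
    proof cases
      case 4
      then show ?thesis using rows(5) g by simp
    qed (use rows(1-4) A B r s in auto)
  next
    case False
    then show ?thesis using rows(6) \<beta> by (simp add: coord_space_def)
  qed
  have nnU: "0 \<le> ?u i j" if "i \<le> d1" "j \<le> d2" for i j
    using co that by (auto simp: comonotone_def)
  have uU: "?u i j = f (U i j)" if "U i j \<in> col_labels d1 d2" for i j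
    using that by (auto simp: u_matrix_def col_labels_iff)
  have "0 \<le> f c" if c: "c \<in> col_labels d1 d2" for c
  proof (cases c)
    case (U i j)
    then show ?thesis using c uU[of i j] nnU[of i j] by (auto simp: col_labels_iff)
  next
    case (A1 i)
    then have "i \<le> d1" using c by (auto simp: col_labels_iff)
    then show ?thesis using A oA A1 by (force simp: solves_obstacle_def)
  next
    case (A2 i)
    then have "i \<le> d1" using c by (auto simp: col_labels_iff)
    then show ?thesis using oA A2 by (force simp: solves_obstacle_def)
  next
    case (B1 i)
    then have "i \<le> d2" using c by (auto simp: col_labels_iff)
    then show ?thesis using B oB B1 by (force simp: solves_obstacle_def)
  next
    case (B2 i)
    then have "i \<le> d2" using c by (auto simp: col_labels_iff)
    then show ?thesis using oB B2 by (force simp: solves_obstacle_def)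
  qed
  moreover have "\<exists>c\<in>P. f c = 0" if P: "P \<in> label_Pi d1 d2" for P
  proof -
    have lab: "P \<subseteq> col_labels d1 d2" using P Union_label_Pi[OF d] by blast
    have At: "f (A1 i) = 0 \<or> f (A2 i) = 0" if "i \<le> d1" "f (A2 i) = max 0 (- \<beta> (Z i))" for i
      using A that by (auto simp: max_def split: if_splits)
    have Bt: "f (B1 i) = 0 \<or> f (B2 i) = 0" if "i \<le> d2" "f (B2 i) = max 0 (- \<beta> (W i))" for i
      using B that by (auto simp: max_def split: if_splits)
    show ?thesis
      using P
    proof (cases rule: label_Pi_E)
      case (A i)
      then show ?thesis using At[of i] oA by (auto simp: solves_obstacle_def)
    next
      case (B j)
      then show ?thesis using Bt[of j] oB by (auto simp: solves_obstacle_def)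
    next
      case (AU i j)
      then have j: "j \<le> d2" and ui: "f (U i j) = ?u i j"
        using lab uU by (auto simp: col_labels_iff)
      \<comment> \<open>Either \<open>x\<close> touches the obstacle and \<open>A1 i\<close> or
        \<open>A2 i\<close> has coefficient zero, or the row sum is zero and nonnegativity forces
        each entry of the row to vanish.\<close>
      have "f (A2 i) = max 0 (- \<beta> (Z i)) \<or> (\<Sum>j\<le>d2. ?u i j) = 0"
      proof -
        have i: "i \<in> {1..<d1}" using AU by simp
        then have "f (A2 i) = max 0 (- \<beta> (Z i)) \<or>
            f (A2 (i - 1)) - 2 * f (A2 i) + f (A2 (i + 1)) = \<beta> (G1 i)"
          using oA unfolding solves_obstacle_def by blast
        then show ?thesis unfolding r[OF i] by linarith
      qed
      moreover have "?u i j \<le> (\<Sum>j\<le>d2. ?u i j)" "0 \<le> ?u i j"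
        using nnU j AU by (auto intro!: member_le_sum)
      ultimately show ?thesis using At[of i] AU ui by auto
    next
      case (BU i j)
      then have i: "i \<le> d1" and ui: "f (U i j) = ?u i j"
        using lab uU by (auto simp: col_labels_iff)
      have "f (B2 j) = max 0 (- \<beta> (W j)) \<or> (\<Sum>i\<le>d1. ?u i j) = 0"
      proof -
        have j: "j \<in> {1..<d2}" using BU by simp
        then have "f (B2 j) = max 0 (- \<beta> (W j)) \<or>
            f (B2 (j - 1)) - 2 * f (B2 j) + f (B2 (j + 1)) = \<beta> (G2 j)"
          using oB unfolding solves_obstacle_def by blast
        then show ?thesis unfolding s[OF j] by linarith
      qed
      moreover have "?u i j \<le> (\<Sum>i\<le>d1. ?u i j)" "0 \<le> ?u i j"
        using nnU i BU by (auto intro!: member_le_sum[where f = "\<lambda>i. ?u i j"])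
      ultimately show ?thesis using Bt[of j] BU ui by auto
    next
      case (UU i j k l)
      then have "k \<le> d1" "j \<le> d2" "f (U i j) = ?u i j" "f (U k l) = ?u k l"
        using lab uU by (auto simp: col_labels_iff)
      moreover from this have "?u i j = 0 \<or> ?u k l = 0"
        using co UU unfolding comonotone_def by blast
      ultimately show ?thesis using UU(1) by auto
    qed
  qed
  ultimately show "mv_solution d1 d2 \<beta> f"
    unfolding mv_solution_def Min_label_Pi_iff[OF d] using lin by blast
qed

section \<open>Existence and uniqueness for label families\<close>

lemma mv_solution_exists:
  assumes d: "0 < d1" "0 < d2" and \<beta>: "\<beta> \<in> coord_space (row_labels d1 d2)"
  shows "\<exists>f. mv_solution d1 d2 \<beta> f"
proof -
  obtain x where x: "solves_obstacle d1 (\<lambda>i. \<beta> (G1 i)) (\<lambda>i. max 0 (- \<beta> (Z i))) x"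
    using obstacle_exists by blast
  obtain y where y: "solves_obstacle d2 (\<lambda>j. \<beta> (G2 j)) (\<lambda>j. max 0 (- \<beta> (W j))) y"
    using obstacle_exists by blast
  \<comment> \<open>The inequalities in the obstacle problems say precisely that the inner marginals
    prescribed here are nonnegative.\<close>
  have "\<exists>u. corner_coupling d1 d2
      (\<lambda>i. \<beta> (G1 i) - (x (i - 1) - 2 * x i + x (i + 1)))
      (\<lambda>j. \<beta> (G2 j) - (y (j - 1) - 2 * y j + y (j + 1)))
      (\<beta> G - (x 0 - x 1 - y 0 + y 1)) u"
    by (rule corner_coupling_exists[OF d]) (use x y in \<open>auto simp: solves_obstacle_def\<close>)
  then obtain u where u: "corner_coupling d1 d2
      (\<lambda>i. \<beta> (G1 i) - (x (i - 1) - 2 * x i + x (i + 1)))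
      (\<lambda>j. \<beta> (G2 j) - (y (j - 1) - 2 * y j + y (j + 1)))
      (\<beta> G - (x 0 - x 1 - y 0 + y 1)) u"
    by blast
  define f where "f c = (case c of A1 i \<Rightarrow> x i + \<beta> (Z i) | A2 i \<Rightarrow> x i
    | B1 j \<Rightarrow> y j + \<beta> (W j) | B2 j \<Rightarrow> y j | U i j \<Rightarrow> u i j)" for c
  have "u_matrix d1 d2 f = u"
    using u by (auto simp: fun_eq_iff u_matrix_def f_def corner_coupling_def)
  then have "mv_solution d1 d2 \<beta> f"
    unfolding mv_solution_iff[OF d \<beta>] using x y u by (simp add: f_def)
  then show ?thesis by blast
qed

text \<open>The characterisation is triangular: the obstacle problems fix the coefficients of
  \<open>A2\<close> and \<open>B2\<close>, these fix the data of the coupling and hence those of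
  \<open>U\<close>, and the rows \<open>Z\<close> and \<open>W\<close> give those of
  \<open>A1\<close> and \<open>B1\<close>.\<close>

lemma mv_solution_unique:
  assumes d: "0 < d1" "0 < d2" and \<beta>: "\<beta> \<in> coord_space (row_labels d1 d2)"
    and f: "mv_solution d1 d2 \<beta> f" and g: "mv_solution d1 d2 \<beta> g" and c: "c \<in> col_labels d1 d2"
  shows "f c = g c"
proof -
  note F = iffD1[OF mv_solution_iff[OF d \<beta>] f] and G = iffD1[OF mv_solution_iff[OF d \<beta>] g]
  note F1 = F[THEN conjunct1] and F2 = F[THEN conjunct2, THEN conjunct1]
    and F3 = F[THEN conjunct2, THEN conjunct2, THEN conjunct1]
    and F4 = F[THEN conjunct2, THEN conjunct2, THEN conjunct2, THEN conjunct1]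
    and F5 = F[THEN conjunct2, THEN conjunct2, THEN conjunct2, THEN conjunct2]
  note G1 = G[THEN conjunct1] and G2 = G[THEN conjunct2, THEN conjunct1]
    and G3 = G[THEN conjunct2, THEN conjunct2, THEN conjunct1]
    and G4 = G[THEN conjunct2, THEN conjunct2, THEN conjunct2, THEN conjunct1]
    and G5 = G[THEN conjunct2, THEN conjunct2, THEN conjunct2, THEN conjunct2]
  have x: "f (A2 i) = g (A2 i)" if "i \<le> d1" for i
    using obstacle_unique[OF F3 G3 that] .
  have y: "f (B2 i) = g (B2 i)" if "i \<le> d2" for i
    using obstacle_unique[OF F4 G4 that] .
  \<comment> \<open>To compare the two matrices, the coupling of \<open>g\<close> is restated with
    the data of \<open>f\<close>; these involve \<open>A2\<close> and \<open>B2\<close> only at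
    indices in range.\<close>
  have C: "corner_coupling d1 d2
      (\<lambda>i. \<beta> (G1 i) - (f (A2 (i - 1)) - 2 * f (A2 i) + f (A2 (i + 1))))
      (\<lambda>j. \<beta> (G2 j) - (f (B2 (j - 1)) - 2 * f (B2 j) + f (B2 (j + 1))))
      (\<beta> G - (f (A2 0) - f (A2 1) - f (B2 0) + f (B2 1))) (u_matrix d1 d2 g)"
  proof (rule corner_coupling_cong[OF G5])
    fix i assume "i \<in> {1..<d1}"
    then show "\<beta> (G1 i) - (g (A2 (i - 1)) - 2 * g (A2 i) + g (A2 (i + 1))) =
        \<beta> (G1 i) - (f (A2 (i - 1)) - 2 * f (A2 i) + f (A2 (i + 1)))"
      using x[of "i - 1"] x[of i] x[of "i + 1"] by auto
  next
    fix j assume "j \<in> {1..<d2}"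
    then show "\<beta> (G2 j) - (g (B2 (j - 1)) - 2 * g (B2 j) + g (B2 (j + 1))) =
        \<beta> (G2 j) - (f (B2 (j - 1)) - 2 * f (B2 j) + f (B2 (j + 1)))"
      using y[of "j - 1"] y[of j] y[of "j + 1"] by auto
  next
    show "\<beta> G - (g (A2 0) - g (A2 1) - g (B2 0) + g (B2 1)) =
        \<beta> G - (f (A2 0) - f (A2 1) - f (B2 0) + f (B2 1))"
      using x[of 0] x[of 1] y[of 0] y[of 1] d by simp
  qed
  have u: "u_matrix d1 d2 f i j = u_matrix d1 d2 g i j" if "i \<le> d1" "j \<le> d2" for i j
    using corner_coupling_unique[OF d F5 C that] .
  have z: "f (A1 i) = g (A1 i)" if "i \<le> d1" for i
    using F1[rule_format, OF that] G1[rule_format, OF that] x[OF that] by simp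
  have w: "f (B1 i) = g (B1 i)" if "i \<le> d2" for i
    using F2[rule_format, OF that] G2[rule_format, OF that] y[OF that] by simp
  show ?thesis
  proof (cases c)
    case (U i j)
    then show ?thesis using c u[of i j] by (auto simp: col_labels_iff u_matrix_def)
  qed (use c x y z w in \<open>simp_all add: col_labels_iff\<close>)
qed

section \<open>Transfer from labels to vectors\<close>

theorem theorem4:
  fixes d1 d2 :: nat
  assumes "d1 \<ge> d2" and "d2 > 0"
  shows "pseudo_fan (row_labels d1 d2) (fan_Sigma d1 d2, fan_Ver d1 d2, fan_Pi d1 d2) \<and>
    min_value_condition (row_labels d1 d2) (fan_Sigma d1 d2, fan_Ver d1 d2, fan_Pi d1 d2)"
proof
  have d: "0 < d1" "0 < d2" using assms by auto
  show "pseudo_fan (row_labels d1 d2) (fan_Sigma d1 d2, fan_Ver d1 d2, fan_Pi d1 d2)"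
    by (rule pseudo_fan_Sigma_Ver_Pi[OF d])
  let ?v = "vertex d1 d2" and ?V = "fan_Ver d1 d2"
  note inj = inj_on_vertex[OF d]
  \<comment> \<open>Injectivity of \<open>vertex\<close> allows the sum over vectors to be reindexed
    by labels.\<close>
  have iff: "\<beta> = lin_comb \<alpha> ?V \<and> (\<forall>P\<in>fan_Pi d1 d2. Min (\<alpha> ` P) = 0) \<longleftrightarrow>
      mv_solution d1 d2 \<beta> (\<lambda>c. \<alpha> (?v c))" for \<alpha> \<beta>
    unfolding mv_solution_def lin_comb_def fan_Ver_def fan_Pi_def
    by (simp add: sum.reindex[OF inj] image_image)
  show "min_value_condition (row_labels d1 d2) (fan_Sigma d1 d2, ?V, fan_Pi d1 d2)"
    unfolding min_value_condition_def prod.case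
  proof
    fix \<beta> :: "row_label \<Rightarrow> real"
    assume \<beta>: "\<beta> \<in> coord_space (row_labels d1 d2)"
    obtain f where f: "mv_solution d1 d2 \<beta> f"
      using mv_solution_exists[OF d \<beta>] by blast
    \<comment> \<open>The label solution is carried to vectors by the inverse of
      \<open>vertex\<close>; restriction to \<open>fan_Ver\<close> makes it extensional, so that
      uniqueness as a function reduces to its values on the vectors.\<close>
    define \<alpha> where "\<alpha> = restrict (f \<circ> the_inv_into (col_labels d1 d2) ?v) ?V"
    have \<alpha>: "\<alpha> (?v c) = f c" if "c \<in> col_labels d1 d2" for c
      using that by (simp add: \<alpha>_def fan_Ver_def the_inv_into_f_f[OF inj])
    have "\<alpha> ` ?v ` P = f ` P" if "P \<in> label_Pi d1 d2" for P
      using that \<alpha> Union_label_Pi[OF d] by (force simp: image_image intro!: image_cong)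
    then have sol: "mv_solution d1 d2 \<beta> (\<lambda>c. \<alpha> (?v c))"
      using f \<alpha> by (simp add: mv_solution_def image_image)
    show "\<exists>!\<alpha>. \<alpha> \<in> ?V \<rightarrow>\<^sub>E UNIV \<and> \<beta> = lin_comb \<alpha> ?V \<and> (\<forall>P\<in>fan_Pi d1 d2. Min (\<alpha> ` P) = 0)"
      unfolding iff
    proof (rule ex1I[of _ \<alpha>])
      show "\<alpha> \<in> ?V \<rightarrow>\<^sub>E UNIV \<and> mv_solution d1 d2 \<beta> (\<lambda>c. \<alpha> (?v c))"
        using sol by (auto simp: \<alpha>_def)
    next
      fix \<gamma> assume \<gamma>: "\<gamma> \<in> ?V \<rightarrow>\<^sub>E UNIV \<and> mv_solution d1 d2 \<beta> (\<lambda>c. \<gamma> (?v c))"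
      have "\<gamma> (?v c) = \<alpha> (?v c)" if "c \<in> col_labels d1 d2" for c
        using mv_solution_unique[OF d \<beta> _ sol that] \<gamma> by blast
      then show "\<gamma> = \<alpha>"
        using \<gamma> by (intro extensionalityI[of _ ?V]) (auto simp: fan_Ver_def \<alpha>_def PiE_def)
    qed
  qed
qed

end
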